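(* Let $N\ge 0$ and let $A^N=(a_{mn})_{0\le m,n\le N}\in\mathbb R^{(N+1)\times(N+1)}$ be the truncated Gram matrix of the asymmetric Hermite functions. Let $\overline D^N\in\mathbb R^{(N+1)\times(N+1)}$ be a matrix (possibly depending on time $t$) which satisfies $$A^N\overline D^N+(\overline D^N)^T A^N=0$$ (at every time). Then every differentiable solution $t\mapsto U^N(t)\in\mathbb R^{N+1}$ of $$\partial_t U^N+\overline D^N U^N=0$$ satisfies $$\frac{d}{dt}\left\langle U^N,A^N U^N\right\rangle=0 .$$
   Context: $\langle\cdot,\cdot\rangle$ is the standard Euclidean scalar product. $H_m$ denotes the (physicists') Hermite polynomial, $H_m(x)=(-1)^m e^{x^2}\frac{d^m}{dx^m}e^{-x^2}$. For a fixed $T>0$ the asymmetric Hermite functions are $\psi_m(v)=e^{-v^2/T}T^{-\frac12}(2^m m!\sqrt{\pi})^{-\frac12}H_m(v/\sqrt T)$, $m\ge 0$, and the coefficients of the (symmetric) Gram matrix are $a_{mn}=\int_{\mathbb R}\psi_m(v)\psi_n(v)\,dv$. *)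

theory Defs
  imports "HOL-Analysis.Analysis" "Jordan_Normal_Form.Matrix"
begin

unbundle no vec_syntax and no inner_syntax

text \<open>Physicists' Hermite polynomials, by Rodrigues' formula.\<close>

definition hermite :: "nat \<Rightarrow> real \<Rightarrow> real" where
  "hermite m x = (- 1) ^ m * exp (x\<^sup>2) * (deriv ^^ m) (\<lambda>y. exp (- y\<^sup>2)) x"

definition asym_hermite :: "real \<Rightarrow> nat \<Rightarrow> real \<Rightarrow> real" where
  "asym_hermite T m v =
     exp (- v\<^sup>2 / T) * T powr (- 1 / 2) * (2 ^ m * fact m * sqrt pi) powr (- 1 / 2)
       * hermite m (v / sqrt T)"

definition gram_coeff :: "real \<Rightarrow> nat \<Rightarrow> nat \<Rightarrow> real" where
  "gram_coeff T m n = (LINT v|lborel. asym_hermite T m v * asym_hermite T n v)"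

definition gram_mat :: "real \<Rightarrow> nat \<Rightarrow> real mat" where
  "gram_mat T N = mat (N + 1) (N + 1) (\<lambda>(m, n). gram_coeff T m n)"

text \<open>The type of vectors of variable dimension is not a normed space, so that the
  derivative of a vector-valued function is taken componentwise. The dimension is that
  of the derivative; only the components of \<open>U\<close> below it are constrained.\<close>

definition has_vec_derivative :: "(real \<Rightarrow> real vec) \<Rightarrow> real vec \<Rightarrow> real filter \<Rightarrow> bool"
    (infix "has'_vec'_derivative" 50) where
  "(U has_vec_derivative V) F \<longleftrightarrow>
     (\<forall>i < dim_vec V. ((\<lambda>s. U s $ i) has_real_derivative V $ i) F)"

end

theory Submission
  imports Defs
begin

text \<open>Write \<open>A\<close> for the Gram matrix, which is constant in time. The product rule
  gives d/dt <U, A U> = <U', A U> + <U, A U'>, and the equation replaces U' by -D U. Moving D across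
  the scalar product as its transpose turns the result into -<U, (A D + D^T A) U>, which vanishes by
  the hypothesis on D. The analytic half is \<open>has_real_derivative_quadratic_form\<close>, the
  algebraic half \<open>quadratic_form_skew\<close>. Since vectors are differentiated componentwise,
  the quadratic form is first expanded into coordinates.\<close>

lemma quadratic_form_sum:
  fixes A :: "'a :: semiring_0 mat"
  assumes "A \<in> carrier_mat n n" "v \<in> carrier_vec n" "w \<in> carrier_vec n"
  shows "v \<bullet> (A *\<^sub>v w) = (\<Sum>i<n. v $ i * (\<Sum>j<n. A $$ (i, j) * w $ j))"
  using assms by (auto simp: scalar_prod_def atLeast0LessThan intro!: sum.cong)

text \<open>Product rule for a form with constant coefficients: in coordinates it is a finite sum of
  products of differentiable real functions.\<close>

lemma has_real_derivative_quadratic_form: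
  fixes A :: "real mat"
  assumes A: "A \<in> carrier_mat n n"
    and U: "\<And>s. s \<in> S \<Longrightarrow> U s \<in> carrier_vec n" and V: "V \<in> carrier_vec n"
    and deriv: "(U has_vec_derivative V) (at t within S)" and t: "t \<in> S"
  shows "((\<lambda>s. U s \<bullet> (A *\<^sub>v U s)) has_real_derivative
           V \<bullet> (A *\<^sub>v U t) + U t \<bullet> (A *\<^sub>v V)) (at t within S)"
proof -
  have comp: "((\<lambda>s. U s $ i) has_real_derivative V $ i) (at t within S)" if "i < n" for i
    using deriv V that by (auto simp: has_vec_derivative_def)
  let ?q = "\<lambda>s. \<Sum>i<n. U s $ i * (\<Sum>j<n. A $$ (i, j) * U s $ j)"
  \<comment> \<open>The factors stand in the order in which \<open>DERIV_mult\<close> produces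
    them.\<close>
  have "(?q has_real_derivative
      (\<Sum>i<n. V $ i * (\<Sum>j<n. A $$ (i, j) * U t $ j)
        + (\<Sum>j<n. A $$ (i, j) * V $ j) * U t $ i)) (at t within S)"
    by (intro DERIV_sum DERIV_mult DERIV_cmult comp) auto
  moreover have "(\<Sum>i<n. V $ i * (\<Sum>j<n. A $$ (i, j) * U t $ j)
        + (\<Sum>j<n. A $$ (i, j) * V $ j) * U t $ i) = V \<bullet> (A *\<^sub>v U t) + U t \<bullet> (A *\<^sub>v V)"
    by (simp add: quadratic_form_sum[OF A V U[OF t]] quadratic_form_sum[OF A U[OF t] V]
        sum.distrib mult.commute)
  ultimately have "(?q has_real_derivative V \<bullet> (A *\<^sub>v U t) + U t \<bullet> (A *\<^sub>v V)) (at t within S)"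
    by simp
  \<comment> \<open>The form equals its coordinate sum only where \<open>U s\<close> has dimension
    \<open>n\<close>, that is, on \<open>S\<close>; a derivative within \<open>S\<close> sees no
    more. The radius 1 is arbitrary.\<close>
  then show ?thesis
    by (rule has_field_derivative_transform_within[where d = 1])
      (use t in \<open>simp_all add: quadratic_form_sum[OF A U U]\<close>)
qed

text \<open>Both terms combine into the form of \<open>A * D + transpose_mat D * A\<close> at
  \<open>u\<close>, because D and its transpose are adjoint.\<close>

lemma quadratic_form_skew:
  fixes A D :: "'a :: comm_ring_1 mat"
  assumes A: "A \<in> carrier_mat n n" and D: "D \<in> carrier_mat n n" and u: "u \<in> carrier_vec n"
    and skew: "A * D + transpose_mat D * A = 0\<^sub>m n n"
  shows "(D *\<^sub>v u) \<bullet> (A *\<^sub>v u) + u \<bullet> (A *\<^sub>v (D *\<^sub>v u)) = 0"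
proof -
  have Dt: "transpose_mat D \<in> carrier_mat n n" and Au: "A *\<^sub>v u \<in> carrier_vec n"
    and Du: "D *\<^sub>v u \<in> carrier_vec n"
    using A D u by auto
  \<comment> \<open>Adjointness is applied with \<open>A *\<^sub>v u\<close> in the left slot, hence
    a commutation on either side.\<close>
  have "(D *\<^sub>v u) \<bullet> (A *\<^sub>v u) = u \<bullet> (transpose_mat D *\<^sub>v (A *\<^sub>v u))"
    using transpose_vec_mult_scalar[OF D u Au] comm_scalar_prod[OF Au Du]
      comm_scalar_prod[OF u mult_mat_vec_carrier[OF Dt Au]] by simp
  then have "(D *\<^sub>v u) \<bullet> (A *\<^sub>v u) + u \<bullet> (A *\<^sub>v (D *\<^sub>v u))
      = u \<bullet> (A *\<^sub>v (D *\<^sub>v u) + transpose_mat D *\<^sub>v (A *\<^sub>v u))"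
    using A Dt Au Du u by (subst scalar_prod_add_distrib[of _ n]) auto
  also have "A *\<^sub>v (D *\<^sub>v u) + transpose_mat D *\<^sub>v (A *\<^sub>v u) = (A * D + transpose_mat D * A) *\<^sub>v u"
    using A D Dt u by (simp add: add_mult_distrib_mat_vec[of _ n n])
  also have "u \<bullet> \<dots> = 0"
    using u by (simp add: skew scalar_prod_def)
  finally show ?thesis .
qed

theorem lemma5p1:
  fixes T :: real and N :: nat and I :: "real set"
    and D :: "real \<Rightarrow> real mat" and U U' :: "real \<Rightarrow> real vec"
  assumes "T > 0"
    and "is_interval I"
    and "\<And>t. t \<in> I \<Longrightarrow> D t \<in> carrier_mat (N + 1) (N + 1)"
    and "\<And>t. t \<in> I \<Longrightarrow>
      gram_mat T N * D t + transpose_mat (D t) * gram_mat T N = 0\<^sub>m (N + 1) (N + 1)"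
    and "\<And>t. t \<in> I \<Longrightarrow> U t \<in> carrier_vec (N + 1)"
    and "\<And>t. t \<in> I \<Longrightarrow> U' t \<in> carrier_vec (N + 1)"
    and "\<And>t. t \<in> I \<Longrightarrow> (U has_vec_derivative U' t) (at t within I)"
    and "\<And>t. t \<in> I \<Longrightarrow> U' t + D t *\<^sub>v U t = 0\<^sub>v (N + 1)"
  shows "\<forall>t \<in> I. ((\<lambda>s. U s \<bullet> (gram_mat T N *\<^sub>v U s)) has_real_derivative 0) (at t within I)"
proof
  fix t assume t: "t \<in> I"
  let ?A = "gram_mat T N"
  have A: "?A \<in> carrier_mat (N + 1) (N + 1)"
    by (simp add: gram_mat_def)
  note D = assms(3)[OF t] and Ut = assms(5)[OF t] and U't = assms(6)[OF t]
  have Du: "D t *\<^sub>v U t \<in> carrier_vec (N + 1)" and Au: "?A *\<^sub>v U t \<in> carrier_vec (N + 1)"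
    using A D Ut by auto
  \<comment> \<open>The equation is solved for U' entry by entry, as an identity of real
    numbers.\<close>
  have "U' t $ i = - (D t *\<^sub>v U t) $ i" if "i < N + 1" for i
    using arg_cong[OF assms(8)[OF t], of "\<lambda>v. v $ i"] that D Ut U't
    by (simp add: eq_neg_iff_add_eq_0)
  then have U'_eq: "U' t = - (D t *\<^sub>v U t)"
    using D U't by (intro eq_vecI) auto
  have neg: "?A *\<^sub>v - (D t *\<^sub>v U t) = - (?A *\<^sub>v (D t *\<^sub>v U t))"
    using A D by (intro eq_vecI) auto
  \<comment> \<open>The left side is the derivative from the product rule; substituting for U' pulls
    out one common sign.\<close>
  have "U' t \<bullet> (?A *\<^sub>v U t) + U t \<bullet> (?A *\<^sub>v U' t)
      = - ((D t *\<^sub>v U t) \<bullet> (?A *\<^sub>v U t) + U t \<bullet> (?A *\<^sub>v (D t *\<^sub>v U t)))"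
    unfolding U'_eq neg using A D Ut Du Au by simp
  also have "\<dots> = 0"
    using quadratic_form_skew[OF A D Ut assms(4)[OF t]] by simp
  finally show "((\<lambda>s. U s \<bullet> (?A *\<^sub>v U s)) has_real_derivative 0) (at t within I)"
    using has_real_derivative_quadratic_form[OF A assms(5) U't assms(7)[OF t] t] by simp
qed

end
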